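(* Let $\alpha,\beta\in(0,1/2)$, and consider the distributed sequential test described in the context, with noise model, connected graph $G$, and weight matrix $\mathbf W$ as specified there. 1) For these $\alpha,\beta$ there exist thresholds $\gamma_{d,i}^{h}$ and $\gamma_{d,i}^{l}$, $i=1,\dots,N$, such that $\mathbb{P}_{FA}^{d,i}\le\alpha$ and $\mathbb{P}_{M}^{d,i}\le\beta$ for every $i$, and the test concludes in finite time a.s., i.e. $\mathbb{P}_1(T_{d,i}<\infty)=1$ for all $i=1,\dots,N$. 2) In particular, with $k=Nr^2$, any choice of thresholds satisfying $$\gamma_{d,i}^{h}\ \ge\ \gamma_d^{h,0}:=\frac{8(k+1)}{7N}\left(\log\left(\frac{2}{\alpha}\right)-\log\left(1-e^{-\frac{Nm}{4(k+1)}}\right)\right),$$ $$\gamma_{d,i}^{l}\ \le\ \gamma_d^{l,0}:=\frac{8(k+1)}{7N}\left(\log\left(\frac{\beta}{2}\right)+\log\left(1-e^{-\frac{Nm}{4(k+1)}}\right)\right)$$ achieves a.s. finite stopping at agent $i$ (i.e. $\mathbb{P}_1(T_{d,i}<\infty)=1$) while ensuring $\mathbb{P}_{FA}^{d,i}\le\alpha$ and $\mathbb{P}_{M}^{d,i}\le\beta$.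
   Context: Observation model: there are $N$ agents; at each time $t=1,2,\dots$ agent $i$ observes $y_i(t)=\mu_\theta+n_i(t)$ under hypothesis $H_\theta$, $\theta\in\{0,1\}$, with $\mu_1=\mu$, $\mu_0=-\mu$, $\mu\neq 0$. The noises $n_i(t)$ are independent over all agents $i$ and times $t$, each Gaussian with mean $0$ and variance $\sigma^2>0$, under both hypotheses. $\mathbb{P}_\theta,\mathbb{E}_\theta$ denote probability and expectation under $H_\theta$. The log-likelihood ratio at agent $i$ is $\eta_i(t)=2\mu y_i(t)/\sigma^2$, and $\boldsymbol\eta(t)=(\eta_1(t),\dots,\eta_N(t))^\top$. Put $m=2\mu^2/\sigma^2$; thus $\eta_i(t)\sim\mathcal N(m,2m)$ under $H_1$ and $\mathcal N(-m,2m)$ under $H_0$ (mean, variance). Network: $G=(V,E)$ is a connected simple undirected graph on the agents $V=\{1,\dots,N\}$. $\mathbf W=[w_{ij}]$ is an $N\times N$ non-negative, symmetric, irreducible, stochastic (rows sum to one) matrix with $w_{ij}=0$ whenever $i\ne j$ and $(i,j)\notin E$. Let $\mathbf J=\frac1N\mathbf 1\mathbf 1^\top$ and $r=\|\mathbf W-\mathbf J\|$ (induced $\mathcal L_2$ norm), and assume $r<1$. Test: the vector of agent statistics $\mathbf S_d(t)=(S_{d,1}(t),\dots,S_{d,N}(t))^\top$ is given by $\mathbf S_d(0)=\mathbf 0$ and $\mathbf S_d(t+1)=\mathbf W(\mathbf S_d(t)+\boldsymbol\eta(t+1))$, i.e. $S_{d,i}(t)=\sum_{j=1}^t\mathbf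 e_i^\top\mathbf W^{t+1-j}\boldsymbol\eta(j)$. Given thresholds $\gamma_{d,i}^l,\gamma_{d,i}^h\in\mathbb R$, the stopping time of agent $i$ is $T_{d,i}=\inf\{t\ge1: S_{d,i}(t)\notin[\gamma_{d,i}^l,\gamma_{d,i}^h]\}$; at $T_{d,i}$ agent $i$ decides $H_0$ if $S_{d,i}(T_{d,i})\le\gamma_{d,i}^l$ and $H_1$ if $S_{d,i}(T_{d,i})\ge\gamma_{d,i}^h$. The error probabilities are $\mathbb{P}_{FA}^{d,i}=\mathbb{P}_0(S_{d,i}(T_{d,i})\ge\gamma_{d,i}^h)$ and $\mathbb{P}_{M}^{d,i}=\mathbb{P}_1(S_{d,i}(T_{d,i})\le\gamma_{d,i}^l)$ (the events being understood to include $T_{d,i}<\infty$). $\log$ is the natural logarithm. *)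

theory Defs
  imports "HOL-Probability.Probability"
begin

text \<open>Agents are the elements of a finite type \<open>'n\<close>, so \<open>N = CARD('n)\<close>.\<close>

definition simple_connected_graph :: "('n \<times> 'n) set \<Rightarrow> bool" where
  "simple_connected_graph E \<longleftrightarrow> sym E \<and> irrefl E \<and> (\<forall>i j. (i, j) \<in> E\<^sup>*)"

text \<open>Reducible: a simultaneous permutation of rows and columns (listing the indices in \<open>S\<close>
  last) makes the matrix block upper triangular with two nonempty square diagonal blocks.\<close>

definition irreducible_matrix :: "real ^ 'n ^ 'n \<Rightarrow> bool" where
  "irreducible_matrix A \<longleftrightarrow>
     \<not> (\<exists>S. S \<noteq> {} \<and> S \<noteq> UNIV \<and> (\<forall>i\<in>S. \<forall>j\<in>-S. A $ i $ j = 0))"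

definition weight_matrix :: "('n \<times> 'n) set \<Rightarrow> real ^ 'n ^ 'n \<Rightarrow> bool" where
  "weight_matrix E W \<longleftrightarrow>
     (\<forall>i j. 0 \<le> W $ i $ j) \<and>
     transpose W = W \<and>
     irreducible_matrix W \<and>
     (\<forall>i. (\<Sum>j\<in>UNIV. W $ i $ j) = 1) \<and>
     (\<forall>i j. i \<noteq> j \<and> (i, j) \<notin> E \<longrightarrow> W $ i $ j = 0)"

definition averaging_matrix :: "real ^ 'n ^ 'n" where
  "averaging_matrix = (\<chi> i j. 1 / real CARD('n))"

definition mixing_rate :: "real ^ 'n ^ 'n \<Rightarrow> real" where
  "mixing_rate W = onorm ((*v) (W - averaging_matrix))"

text \<open>The observations \<open>y\<close> are common to both hypotheses; the law \<open>M\<close> of the sample point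
  varies. Under \<open>M\<close> with mean \<open>a\<close> the noise is \<open>y i t - a\<close>. Only times \<open>t \<ge> 1\<close> matter.\<close>

definition gaussian_observations ::
  "'w measure \<Rightarrow> ('n \<Rightarrow> nat \<Rightarrow> 'w \<Rightarrow> real) \<Rightarrow> real \<Rightarrow> real \<Rightarrow> bool" where
  "gaussian_observations M y a \<sigma> \<longleftrightarrow>
     prob_space M \<and>
     prob_space.indep_vars M (\<lambda>_. borel) (\<lambda>(i, t) \<omega>. y i t \<omega> - a) (UNIV \<times> {1..}) \<and>
     (\<forall>i. \<forall>t\<ge>1. distributed M lborel (\<lambda>\<omega>. y i t \<omega> - a) (normal_density 0 \<sigma>))"

definition llr ::
  "real \<Rightarrow> real \<Rightarrow> ('n \<Rightarrow> nat \<Rightarrow> 'w \<Rightarrow> real) \<Rightarrow> nat \<Rightarrow> 'w \<Rightarrow> real ^ 'n" where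
  "llr \<mu> \<sigma> y t \<omega> = (\<chi> i. 2 * \<mu> * y i t \<omega> / \<sigma>\<^sup>2)"

primrec agent_stats ::
  "real ^ 'n ^ 'n \<Rightarrow> (nat \<Rightarrow> 'w \<Rightarrow> real ^ 'n) \<Rightarrow> nat \<Rightarrow> 'w \<Rightarrow> real ^ 'n" where
  "agent_stats W \<eta> 0 \<omega> = 0"
| "agent_stats W \<eta> (Suc t) \<omega> = W *v (agent_stats W \<eta> t \<omega> + \<eta> (Suc t) \<omega>)"

text \<open>The infimum is taken in \<open>enat\<close>, so it is \<open>\<infinity>\<close> if the statistic never leaves the interval.
  In the definitions below \<open>s\<close> is the scalar statistic of one agent.\<close>

definition exit_time :: "(nat \<Rightarrow> 'w \<Rightarrow> real) \<Rightarrow> real \<Rightarrow> real \<Rightarrow> 'w \<Rightarrow> enat" where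
  "exit_time s \<gamma>l \<gamma>h \<omega> = Inf {enat t |t. 1 \<le> t \<and> s t \<omega> \<notin> {\<gamma>l..\<gamma>h}}"

definition prob_false_alarm ::
  "'w measure \<Rightarrow> (nat \<Rightarrow> 'w \<Rightarrow> real) \<Rightarrow> real \<Rightarrow> real \<Rightarrow> real" where
  "prob_false_alarm P0 s \<gamma>l \<gamma>h =
     measure P0 {\<omega> \<in> space P0. exit_time s \<gamma>l \<gamma>h \<omega> < \<infinity> \<and>
                               s (the_enat (exit_time s \<gamma>l \<gamma>h \<omega>)) \<omega> \<ge> \<gamma>h}"

definition prob_miss ::
  "'w measure \<Rightarrow> (nat \<Rightarrow> 'w \<Rightarrow> real) \<Rightarrow> real \<Rightarrow> real \<Rightarrow> real" where
  "prob_miss P1 s \<gamma>l \<gamma>h =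
     measure P1 {\<omega> \<in> space P1. exit_time s \<gamma>l \<gamma>h \<omega> < \<infinity> \<and>
                               s (the_enat (exit_time s \<gamma>l \<gamma>h \<omega>)) \<omega> \<le> \<gamma>l}"

definition prob_stops :: "'w measure \<Rightarrow> (nat \<Rightarrow> 'w \<Rightarrow> real) \<Rightarrow> real \<Rightarrow> real \<Rightarrow> real" where
  "prob_stops P1 s \<gamma>l \<gamma>h = measure P1 {\<omega> \<in> space P1. exit_time s \<gamma>l \<gamma>h \<omega> < \<infinity>}"

definition threshold_high :: "real \<Rightarrow> real \<Rightarrow> real \<Rightarrow> real \<Rightarrow> real" where
  "threshold_high N k m \<alpha> =
     8 * (k + 1) / (7 * N) * (ln (2 / \<alpha>) - ln (1 - exp (- (N * m / (4 * (k + 1))))))"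

definition threshold_low :: "real \<Rightarrow> real \<Rightarrow> real \<Rightarrow> real \<Rightarrow> real" where
  "threshold_low N k m \<beta> =
     8 * (k + 1) / (7 * N) * (ln (\<beta> / 2) + ln (1 - exp (- (N * m / (4 * (k + 1))))))"

end

theory Submission
  imports Defs "HOL-Real_Asymp.Real_Asymp"
begin

text \<open>
  Agent \<open>i\<close>'s statistic at time \<open>t\<close> is the sum over \<open>j = 1, \<dots>, t\<close> of the inner products of
  \<open>W\<^bsup>t+1-j\<^esup> e\<^sub>i\<close> with the log-likelihood ratios at time \<open>j\<close>. Since \<open>W\<close> is doubly stochastic and
  contracts the orthogonal complement of the constant vectors by \<open>r\<close>, the squared norm of
  \<open>W\<^sup>n e\<^sub>i\<close> is at most \<open>1/N + r\<^sup>2\<close> for \<open>n \<ge> 1\<close>. So the statistic is normal with mean \<open>\<plusminus>m t\<close> and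
  variance at most \<open>2 m t / c\<close>, where \<open>c = N / (k + 1)\<close>.

  The tail bound \<open>P(Z \<ge> x) \<le> exp (- x\<^sup>2 / 2) / 2\<close> for a standard normal \<open>Z\<close> gives
  \<open>P\<^sub>1(S(t) \<le> g) \<le> exp (a c g - a (1 - a) c m t) / 2\<close> for every \<open>a\<close> and \<open>g \<le> m t\<close>, and symmetrically
  under \<open>P\<^sub>0\<close>. Taking \<open>a = 7/8\<close> and summing the geometric series over \<open>t\<close> bounds both error
  probabilities by \<open>\<alpha>\<close> and \<open>\<beta>\<close> (without the factor \<open>1/2\<close> the bound would exceed them for small \<open>c m\<close>); taking \<open>a = 1/2\<close> and
  letting \<open>t\<close> tend to infinity shows that the test stops almost surely.
\<close>

section \<open>Gaussian tail bound with the factor 1/2\<close>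

text \<open>The reflection u -> 2g - u preserves the density and swaps the two half-lines, which
  meet only in the null set {g}; so twice the integral is 1.\<close>

lemma nn_integral_normal_density_half:
  assumes "0 < s"
  shows "(\<integral>\<^sup>+u. ennreal (normal_density g s u) * indicator {..g} u \<partial>lborel) = ennreal (1/2)"
proof -
  let ?f = "\<lambda>u. ennreal (normal_density g s u)"
  have refl: "(\<integral>\<^sup>+u. ?f u * indicator {..g} u \<partial>lborel) = (\<integral>\<^sup>+u. ?f u * indicator {g..} u \<partial>lborel)"
    by (subst nn_integral_real_affine[where c = "-1" and t = "2 * g"])
       (auto intro!: nn_integral_cong simp: normal_density_def power2_commute indicator_def)
  have "(\<integral>\<^sup>+u. ?f u * indicator {..g} u \<partial>lborel) + (\<integral>\<^sup>+u. ?f u * indicator {..g} u \<partial>lborel)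
      = (\<integral>\<^sup>+u. ?f u * indicator {..g} u + ?f u * indicator {g..} u \<partial>lborel)"
    by (subst (2) refl, subst nn_integral_add) auto
  also have "\<dots> = (\<integral>\<^sup>+u. ?f u \<partial>lborel)"
    using AE_lborel_singleton[of g] by (intro nn_integral_cong_AE) (auto simp: indicator_def)
  also have "\<dots> = 1"
    using assms by (simp add: nn_integral_eq_integral normal_density_nonneg)
  finally have two: "2 * (\<integral>\<^sup>+u. ?f u * indicator {..g} u \<partial>lborel) = 1"
    by (simp add: mult_2)
  then have "(\<integral>\<^sup>+u. ?f u * indicator {..g} u \<partial>lborel) \<noteq> \<top>"
    by (auto simp: ennreal_mult_top)
  then obtain x where x: "0 \<le> x" "(\<integral>\<^sup>+u. ?f u * indicator {..g} u \<partial>lborel) = ennreal x"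
    by (cases "(\<integral>\<^sup>+u. ?f u * indicator {..g} u \<partial>lborel)") auto
  with two have "ennreal (2 * x) = ennreal 1"
    by (simp add: ennreal_mult)
  then have "x = 1/2"
    using x(1) by (subst (asm) ennreal_inj) auto
  with x show ?thesis by simp
qed

text \<open>To the left of \<open>g\<close> the density is dominated by the exponential factor times
  the density centred at \<open>g\<close>, which has mass 1/2 there.\<close>

lemma (in prob_space) prob_normal_lower_tail_le:
  assumes X: "distributed M lborel X (normal_density \<nu> s)"
    and "0 < s" and "g \<le> \<nu>"
  shows "\<P>(\<omega> in M. X \<omega> \<le> g) \<le> 1/2 * exp (- ((\<nu> - g)\<^sup>2 / (2 * s\<^sup>2)))"
proof -
  let ?e = "exp (- ((\<nu> - g)\<^sup>2 / (2 * s\<^sup>2)))"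
  have dens: "normal_density \<nu> s u \<le> ?e * normal_density g s u" if "u \<le> g" for u
  proof -
    \<comment> \<open>Half of the cross term in the expansion of ((\<nu> - g) + (g - u))^2.\<close>
    have "0 \<le> (\<nu> - g) * (g - u)" using that assms by simp
    then have "(\<nu> - g)\<^sup>2 + (u - g)\<^sup>2 \<le> (u - \<nu>)\<^sup>2"
      by (simp add: power2_eq_square algebra_simps)
    then have "((\<nu> - g)\<^sup>2 + (u - g)\<^sup>2) / (2 * s\<^sup>2) \<le> (u - \<nu>)\<^sup>2 / (2 * s\<^sup>2)"
      by (rule divide_right_mono) simp
    then have "exp (- ((u - \<nu>)\<^sup>2 / (2 * s\<^sup>2))) \<le> ?e * exp (- ((u - g)\<^sup>2 / (2 * s\<^sup>2)))"
      by (simp add: exp_add[symmetric] add_divide_distrib)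
    then show ?thesis
      using \<open>0 < s\<close> by (simp add: normal_density_def divide_simps)
  qed
  have "emeasure M {\<omega> \<in> space M. X \<omega> \<le> g} = emeasure (distr M lborel X) {..g}"
    using distributed_measurable[OF X]
    by (subst emeasure_distr) (auto intro!: arg_cong2[where f = emeasure])
  also have "\<dots> = (\<integral>\<^sup>+u. ennreal (normal_density \<nu> s u) * indicator {..g} u \<partial>lborel)"
    by (simp add: distributed_distr_eq_density[OF X] emeasure_density)
  also have "\<dots> \<le> (\<integral>\<^sup>+u. ennreal ?e * (ennreal (normal_density g s u) * indicator {..g} u) \<partial>lborel)"
    using dens by (intro nn_integral_mono)
      (auto simp: indicator_def ennreal_mult''[symmetric] normal_density_nonneg intro!: ennreal_leI)
  also have "\<dots> = ennreal ?e * ennreal (1/2)"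
    by (subst nn_integral_cmult) (simp_all only: nn_integral_normal_density_half[OF \<open>0 < s\<close>], simp)
  also have "\<dots> = ennreal (1/2 * ?e)"
    by (subst ennreal_mult''[symmetric]) simp_all
  finally show ?thesis
    by (simp add: emeasure_eq_measure)
qed

section \<open>Weights of the statistic: powers of the consensus matrix\<close>

text \<open>Symmetry moves \<open>W\<close> to the other side of the inner product, so one time step
  replaces \<open>x\<close> by \<open>W *v x\<close>; hence the induction is over all
  \<open>x\<close>.\<close>

lemma inner_agent_stats:
  fixes W :: "real ^ 'n::finite ^ 'n"
  assumes "transpose W = W"
  shows "x \<bullet> agent_stats W \<eta> t \<omega> = (\<Sum>j=1..t. (((*v) W) ^^ (t + 1 - j)) x \<bullet> \<eta> j \<omega>)"
proof (induction t arbitrary: x)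
  case (Suc t)
  have adj: "x \<bullet> (W *v z) = (W *v x) \<bullet> z" for z
    by (metis assms dot_lmul_matrix vector_transpose_matrix)
  have "x \<bullet> agent_stats W \<eta> (Suc t) \<omega>
      = (\<Sum>j=1..t. (((*v) W) ^^ (t + 1 - j)) (W *v x) \<bullet> \<eta> j \<omega>) + (W *v x) \<bullet> \<eta> (Suc t) \<omega>"
    by (simp add: adj inner_add_right Suc.IH)
  also have "(\<Sum>j=1..t. (((*v) W) ^^ (t + 1 - j)) (W *v x) \<bullet> \<eta> j \<omega>)
      = (\<Sum>j=1..t. (((*v) W) ^^ (Suc t + 1 - j)) x \<bullet> \<eta> j \<omega>)"
    by (intro sum.cong refl arg_cong2[where f = inner])
       (auto simp: funpow_swap1 Suc_diff_le simp del: funpow.simps simp: funpow_Suc_right)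
  finally show ?case by simp
qed simp

lemma sum_mult_doubly_stochastic:
  fixes W :: "real ^ 'n::finite ^ 'n"
  assumes "transpose W = W" "\<And>i. (\<Sum>j\<in>UNIV. W $ i $ j) = 1"
  shows "(\<Sum>i\<in>UNIV. (W *v x) $ i) = (\<Sum>i\<in>UNIV. x $ i)"
proof -
  have sym: "W $ i $ j = W $ j $ i" for i j
    by (metis assms(1) transpose_def vec_lambda_beta)
  have "(\<Sum>i\<in>UNIV. (W *v x) $ i) = (\<Sum>j\<in>UNIV. \<Sum>i\<in>UNIV. W $ i $ j * x $ j)"
    unfolding matrix_vector_mult_def vec_lambda_beta by (rule sum.swap)
  also have "\<dots> = (\<Sum>j\<in>UNIV. (\<Sum>i\<in>UNIV. W $ j $ i) * x $ j)"
    by (intro sum.cong refl) (simp add: sum_distrib_right sym[of _ j for j])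
  finally show ?thesis by (simp add: assms(2))
qed

text \<open>\<open>W\<close> fixes \<open>u\<close>, and averaging sends both \<open>x\<close> and
  \<open>u\<close> to \<open>u\<close>, so the new deviation is \<open>W - averaging_matrix\<close>
  applied to the old one.\<close>

lemma norm_diff_uniform_step:
  fixes W :: "real ^ 'n::finite ^ 'n"
  assumes "\<And>i. (\<Sum>j\<in>UNIV. W $ i $ j) = 1" and "(\<Sum>i\<in>UNIV. x $ i) = 1"
  defines "u \<equiv> (\<chi> i. 1 / real CARD('n)) :: real ^ 'n"
  shows "norm (W *v x - u) \<le> mixing_rate W * norm (x - u)"
proof -
  have "W *v u = u"
    by (simp add: vec_eq_iff matrix_vector_mult_def u_def sum_divide_distrib[symmetric] assms(1))
  moreover have "averaging_matrix *v u = u" "averaging_matrix *v x = u"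
    by (simp_all add: vec_eq_iff matrix_vector_mult_def u_def averaging_matrix_def
        sum_divide_distrib[symmetric] assms(2))
  ultimately have "W *v x - u = (W - averaging_matrix) *v (x - u)"
    by (simp add: matrix_vector_mult_diff_distrib matrix_vector_mult_diff_rdistrib)
  then show ?thesis
    unfolding mixing_rate_def by (simp add: onorm matrix_vector_mul_bounded_linear)
qed

text \<open>Pythagoras: \<open>x\<close> minus the uniform vector is orthogonal to the uniform
  vector.\<close>

lemma norm_sq_eq_uniform_plus:
  fixes x :: "real ^ 'n::finite"
  assumes "(\<Sum>i\<in>UNIV. x $ i) = 1"
  shows "(norm x)\<^sup>2 = (norm (x - (\<chi> i. 1 / real CARD('n))))\<^sup>2 + 1 / real CARD('n)"
proof -
  let ?u = "(\<chi> i. 1 / real CARD('n)) :: real ^ 'n"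
  have "x \<bullet> ?u = 1 / real CARD('n)" "?u \<bullet> ?u = 1 / real CARD('n)"
    using assms by (simp_all add: inner_vec_def sum_divide_distrib[symmetric])
  then show ?thesis
    unfolding power2_norm_eq_inner by (simp add: inner_diff_left inner_diff_right inner_commute)
qed

text \<open>The deviation of \<open>axis i 1\<close> from uniform has norm at most 1, so one step
  brings it to at most r, where r < 1 keeps it. Pythagoras adds 1/N.\<close>

lemma stochastic_power_axis:
  fixes W :: "real ^ 'n::finite ^ 'n" and i :: 'n
  assumes "transpose W = W" "\<And>i. (\<Sum>j\<in>UNIV. W $ i $ j) = 1" and "mixing_rate W < 1"
  defines "v \<equiv> \<lambda>n. (((*v) W) ^^ n) (axis i 1)"
  shows "(\<Sum>l\<in>UNIV. v n $ l) = 1"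
    and "1 \<le> n \<Longrightarrow> (norm (v n))\<^sup>2 \<le> 1 / real CARD('n) + (mixing_rate W)\<^sup>2"
proof -
  let ?r = "mixing_rate W" and ?u = "(\<chi> i. 1 / real CARD('n)) :: real ^ 'n"
  have sum1: "(\<Sum>l\<in>UNIV. v n $ l) = 1" for n
    by (induction n) (simp_all add: v_def sum_mult_doubly_stochastic assms(1,2) axis_def)
  then show "(\<Sum>l\<in>UNIV. v n $ l) = 1" .
  have r0: "0 \<le> ?r"
    unfolding mixing_rate_def by (simp add: onorm_pos_le matrix_vector_mul_bounded_linear)
  have step: "norm (v (Suc n) - ?u) \<le> ?r * norm (v n - ?u)" for n
    using norm_diff_uniform_step[OF assms(2) sum1[of n]] by (simp add: v_def)
  have "(norm (v 0 - ?u))\<^sup>2 \<le> 1"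
  proof -
    have "0 \<le> 1 / real CARD('n)" by simp
    moreover have "(norm (v 0))\<^sup>2 = 1" by (simp add: v_def)
    ultimately show ?thesis
      using norm_sq_eq_uniform_plus[OF sum1[of 0]] by linarith
  qed
  then have "norm (v 0 - ?u) \<le> 1"
    using power2_le_imp_le[of _ 1] by simp
  then have one: "norm (v (Suc 0) - ?u) \<le> ?r"
    using step[of 0] r0 mult_left_mono[of _ 1 ?r] by fastforce
  have "norm (v (Suc n) - ?u) \<le> ?r" for n
  proof (induction n)
    case (Suc n)
    have "norm (v (Suc (Suc n)) - ?u) \<le> ?r * norm (v (Suc n) - ?u)" by (rule step)
    also have "\<dots> \<le> 1 * ?r"
      using Suc r0 assms(3) by (intro mult_mono) auto
    finally show ?case by simp
  qed (fact one)
  moreover assume "1 \<le> n"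
  ultimately have "norm (v n - ?u) \<le> ?r"
    by (cases n) auto
  then have "(norm (v n - ?u))\<^sup>2 \<le> ?r\<^sup>2"
    by (rule power_mono) simp
  then show "(norm (v n))\<^sup>2 \<le> 1 / real CARD('n) + ?r\<^sup>2"
    using norm_sq_eq_uniform_plus[OF sum1[of n]] by simp
qed

section \<open>Normal law of one agent's statistic\<close>

text \<open>The statistic is an affine combination of independent noises. The weights belonging to
  one time sum to 1, which gives the mean; their squared norm bounds the variance.\<close>

lemma agent_stats_normal:
  fixes W :: "real ^ 'n::finite ^ 'n" and i :: 'n
  assumes obs: "gaussian_observations M y a \<sigma>" and "0 < \<sigma>" "\<mu> \<noteq> 0"
    and W: "transpose W = W" "\<And>i. (\<Sum>j\<in>UNIV. W $ i $ j) = 1" "mixing_rate W < 1"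
    and "1 \<le> t"
  obtains s where "0 < s"
    and "s\<^sup>2 \<le> 4 * \<mu>\<^sup>2 / \<sigma>\<^sup>2 * (real t * (1 / real CARD('n) + (mixing_rate W)\<^sup>2))"
    and "distributed M lborel (\<lambda>\<omega>. agent_stats W (llr \<mu> \<sigma> y) t \<omega> $ i)
           (normal_density (real t * (2 * \<mu> * a / \<sigma>\<^sup>2)) s)"
proof -
  interpret prob_space M
    using obs by (simp add: gaussian_observations_def)
  define v where "v n = (((*v) W) ^^ n) (axis i 1)" for n
  have v1: "(\<Sum>l\<in>UNIV. v n $ l) = 1" for n
    unfolding v_def by (rule stochastic_power_axis(1)[OF W])
  have v2: "(norm (v n))\<^sup>2 \<le> 1 / real CARD('n) + (mixing_rate W)\<^sup>2" if "1 \<le> n" for n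
    unfolding v_def by (rule stochastic_power_axis(2)[OF W that])
  \<comment> \<open>Weight of agent \<open>l\<close>'s observation at time \<open>j\<close>. For
    \<open>j\<close> in \<open>{1..t}\<close> the exponent is at least 1, as \<open>v2\<close>
    requires.\<close>
  define w where "w = (\<lambda>(l, j). v (t + 1 - j) $ l)"
  define c where "c = 2 * \<mu> / \<sigma>\<^sup>2"
  \<comment> \<open>Zero weights are excluded because \<open>sum_indep_normal\<close> needs positive standard deviations.\<close>
  define I where "I = {p \<in> UNIV \<times> {1..t}. w p \<noteq> 0}"
  define X where "X p \<omega> = w p * c * a + w p * c * (y (fst p) (snd p) \<omega> - a)" for p \<omega>
  define s where "s = sqrt (\<Sum>p\<in>I. (\<bar>w p * c\<bar> * \<sigma>)\<^sup>2)"
  have c: "c \<noteq> 0" using assms by (simp add: c_def)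
  have finI: "finite I" by (simp add: I_def)
  have sumI: "(\<Sum>p\<in>I. f p) = (\<Sum>j=1..t. \<Sum>l\<in>UNIV. f (l, j))"
    if "\<And>p. w p = 0 \<Longrightarrow> f p = 0" for f :: "'n \<times> nat \<Rightarrow> real"
  proof -
    have "(\<Sum>p\<in>I. f p) = (\<Sum>p\<in>UNIV \<times> {1..t}. f p)"
      using that by (intro sum.mono_neutral_left) (auto simp: I_def)
    also have "\<dots> = (\<Sum>l\<in>UNIV. \<Sum>j=1..t. f (l, j))"
      by (simp add: sum.cartesian_product)
    also have "\<dots> = (\<Sum>j=1..t. \<Sum>l\<in>UNIV. f (l, j))"
      by (rule sum.swap)
    finally show ?thesis .
  qed
  \<comment> \<open>The weights at time 1 are the coordinates of \<open>v t\<close>, which sum to 1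
    and so cannot all vanish.\<close>
  have neI: "I \<noteq> {}"
  proof
    assume "I = {}"
    then have "w (l, 1) = 0" for l
      using \<open>1 \<le> t\<close> unfolding I_def by force
    then show False
      using v1[of t] by (simp add: w_def)
  qed
  have stat: "agent_stats W (llr \<mu> \<sigma> y) t \<omega> $ i = (\<Sum>p\<in>I. X p \<omega>)" for \<omega>
  proof -
    have "agent_stats W (llr \<mu> \<sigma> y) t \<omega> $ i = axis i 1 \<bullet> agent_stats W (llr \<mu> \<sigma> y) t \<omega>"
      by (simp add: inner_axis')
    also have "\<dots> = (\<Sum>j=1..t. v (t + 1 - j) \<bullet> llr \<mu> \<sigma> y j \<omega>)"
      unfolding v_def by (rule inner_agent_stats[OF W(1)])
    also have "\<dots> = (\<Sum>j=1..t. \<Sum>l\<in>UNIV. X (l, j) \<omega>)"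
      unfolding inner_vec_def inner_real_def
      by (intro sum.cong refl)
         (simp add: llr_def X_def w_def c_def right_diff_distrib diff_divide_distrib)
    also have "\<dots> = (\<Sum>p\<in>I. X p \<omega>)"
      by (rule sumI[symmetric]) (simp add: X_def)
    finally show ?thesis .
  qed
  have "indep_vars (\<lambda>_. borel) (\<lambda>(i, t) \<omega>. y i t \<omega> - a) (UNIV \<times> {1..})"
    using obs by (simp add: gaussian_observations_def)
  then have "indep_vars (\<lambda>_. borel) (\<lambda>(i, t) \<omega>. y i t \<omega> - a) I"
    by (rule indep_vars_subset) (auto simp: I_def)
  then have "indep_vars (\<lambda>_. borel)
      (\<lambda>p \<omega>. w p * c * a + w p * c * ((\<lambda>(i, t) \<omega>. y i t \<omega> - a) p \<omega>)) I"
    by (rule indep_vars_compose2) auto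
  then have indep: "indep_vars (\<lambda>_. borel) X I"
    by (simp add: X_def[abs_def] case_prod_beta)
  have dist: "distributed M lborel (X p) (normal_density (w p * c * a) (\<bar>w p * c\<bar> * \<sigma>))"
    if "p \<in> I" for p
  proof -
    have "distributed M lborel (\<lambda>\<omega>. y (fst p) (snd p) \<omega> - a) (normal_density 0 \<sigma>)"
      using obs that unfolding gaussian_observations_def I_def by auto
    from normal_density_affine[OF this \<open>0 < \<sigma>\<close>, of "w p * c" "w p * c * a"] show ?thesis
      using that c by (simp add: X_def[abs_def] I_def)
  qed
  have pos: "0 < \<bar>w p * c\<bar> * \<sigma>" if "p \<in> I" for p
    using that c \<open>0 < \<sigma>\<close> by (simp add: I_def)
  have "distributed M lborel (\<lambda>\<omega>. \<Sum>p\<in>I. X p \<omega>) (normal_density (\<Sum>p\<in>I. w p * c * a) s)"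
    unfolding s_def by (intro sum_indep_normal finI neI indep pos dist)
  moreover have "(\<Sum>p\<in>I. w p * c * a) = real t * (2 * \<mu> * a / \<sigma>\<^sup>2)"
  proof -
    have "(\<Sum>p\<in>I. w p * c * a) = (\<Sum>j=1..t. \<Sum>l\<in>UNIV. w (l, j) * c * a)"
      by (rule sumI) simp
    also have "\<dots> = (\<Sum>j=1..t. (\<Sum>l\<in>UNIV. v (t + 1 - j) $ l) * (c * a))"
      by (simp add: w_def sum_distrib_right mult.assoc)
    also have "\<dots> = real t * (2 * \<mu> * a / \<sigma>\<^sup>2)"
      by (simp only: v1) (simp add: c_def)
    finally show ?thesis .
  qed
  ultimately have D: "distributed M lborel (\<lambda>\<omega>. agent_stats W (llr \<mu> \<sigma> y) t \<omega> $ i)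
           (normal_density (real t * (2 * \<mu> * a / \<sigma>\<^sup>2)) s)"
    by (simp add: stat)
  have s0: "0 < s"
    unfolding s_def using pos by (intro real_sqrt_gt_zero sum_pos finI neI) (metis zero_less_power)
  have "s\<^sup>2 = (\<Sum>p\<in>I. (\<bar>w p * c\<bar> * \<sigma>)\<^sup>2)"
    unfolding s_def by (simp add: sum_nonneg)
  also have "\<dots> = (\<Sum>j=1..t. \<Sum>l\<in>UNIV. (\<bar>w (l, j) * c\<bar> * \<sigma>)\<^sup>2)"
    by (rule sumI) simp
  also have "\<dots> = (\<Sum>j=1..t. c\<^sup>2 * \<sigma>\<^sup>2 * (norm (v (t + 1 - j)))\<^sup>2)"
    unfolding power2_norm_eq_inner inner_vec_def w_def
    by (simp add: sum_distrib_left power_mult_distrib mult_ac flip: power2_eq_square)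
  also have "\<dots> \<le> (\<Sum>j=1..t. c\<^sup>2 * \<sigma>\<^sup>2 * (1 / real CARD('n) + (mixing_rate W)\<^sup>2))"
    by (intro sum_mono mult_left_mono v2) auto
  also have "\<dots> = 4 * \<mu>\<^sup>2 / \<sigma>\<^sup>2 * (real t * (1 / real CARD('n) + (mixing_rate W)\<^sup>2))"
    using \<open>0 < \<sigma>\<close> by (simp add: c_def power2_eq_square field_simps)
  finally show thesis
    using that[OF s0 _ D] by blast
qed

section \<open>Boundary crossing of normal variables with linear drift\<close>

text \<open>The quadratic tail exponent is replaced by a tangent that is linear in \<open>t\<close>,
  so that the bounds can be summed as a geometric series.\<close>

lemma (in prob_space) drifting_normal_tail:
  assumes X: "distributed M lborel X (normal_density (real t * m) s)"
    and "0 < s" "s\<^sup>2 \<le> 2 * m * real t / c" "0 < m" "0 < c" "g \<le> real t * m" "1 \<le> t"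
  shows "\<P>(\<omega> in M. X \<omega> \<le> g) \<le> 1/2 * exp (a * c * g - a * (1 - a) * c * m * real t)"
proof -
  let ?d = "real t * m - g" and ?V = "2 * m * real t / c"
  have V: "0 < ?V" using assms by simp
  \<comment> \<open>\<open>d\<^sup>2 / (4mt) \<ge> a d - a\<^sup>2 m t\<close> is \<open>(d - 2 a m t)\<^sup>2 \<ge> 0\<close>.\<close>
  have "(a * c * ?d - a\<^sup>2 * c * m * real t) * (2 * ?V) \<le> ?d\<^sup>2"
    using \<open>0 < c\<close> zero_le_power2[of "?d - 2 * a * m * real t"]
    by (simp add: power2_eq_square algebra_simps)
  then have "a * c * ?d - a\<^sup>2 * c * m * real t \<le> ?d\<^sup>2 / (2 * ?V)"
    using V by (subst pos_le_divide_eq) auto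
  also have "\<dots> \<le> ?d\<^sup>2 / (2 * s\<^sup>2)"
    using assms V by (intro divide_left_mono mult_pos_pos) auto
  finally have "- (?d\<^sup>2 / (2 * s\<^sup>2)) \<le> a * c * g - a * (1 - a) * c * m * real t"
    by (simp add: power2_eq_square algebra_simps)
  then have "1/2 * exp (- (?d\<^sup>2 / (2 * s\<^sup>2))) \<le> 1/2 * exp (a * c * g - a * (1 - a) * c * m * real t)"
    by simp
  with prob_normal_lower_tail_le[OF X \<open>0 < s\<close> \<open>g \<le> real t * m\<close>] show ?thesis
    by linarith
qed

text \<open>Union bound over t \<ge> 1 with a = 7/8; the series has ratio \<open>q\<close>, as 7/8 *
  1/8 = 7/64. Taking \<open>A\<close> as any subset spares a measurability proof for the error
  events.\<close>

lemma (in prob_space) drifting_normal_ever_below: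
  assumes X: "\<And>t. 1 \<le> t \<Longrightarrow> distributed M lborel (X t) (normal_density (real t * m) (s t))"
    and s: "\<And>t. 1 \<le> t \<Longrightarrow> 0 < s t" "\<And>t. 1 \<le> t \<Longrightarrow> (s t)\<^sup>2 \<le> 2 * m * real t / c"
    and "0 < m" "0 < c" "0 < \<delta>" "\<delta> < 1"
    and g: "g \<le> - (8 / (7 * c) * (ln (2 / \<delta>) - ln (1 - exp (- (c * m / 4)))))"
    and A: "A \<subseteq> {\<omega> \<in> space M. \<exists>t\<ge>1. X t \<omega> \<le> g}"
  shows "prob A \<le> \<delta>"
proof -
  define p where "p = exp (- (c * m / 4))"
  define q where "q = exp (- (7 / 64 * c * m))"
  have cm: "0 < c * m" using assms by simp
  then have p: "0 < p" "p < 1" and q: "0 < q" "q < 1"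
    by (auto simp: p_def q_def)
  \<comment> \<open>The factor 7c/8 cancels the 8/(7c) of the threshold.\<close>
  have K: "exp (7 / 8 * c * g) \<le> \<delta> / 2 * (1 - p)"
  proof -
    have "7 / 8 * c * g \<le> 7 / 8 * c * - (8 / (7 * c) * (ln (2 / \<delta>) - ln (1 - p)))"
      using g \<open>0 < c\<close> by (intro mult_left_mono) (auto simp: p_def)
    also have "\<dots> = ln (1 - p) - ln (2 / \<delta>)"
      using \<open>0 < c\<close> by (simp add: field_simps)
    also have "\<dots> = ln (\<delta> / 2 * (1 - p))"
      using \<open>0 < \<delta>\<close> p by (simp only: ln_mult_pos ln_div diff_gt_0_iff_gt half_gt_zero) simp
    finally show ?thesis
      using \<open>0 < \<delta>\<close> p by (metis diff_gt_0_iff_gt exp_le_cancel_iff exp_ln half_gt_zero mult_pos_pos)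
  qed
  \<comment> \<open>This makes \<open>g\<close> nonpositive, hence below every mean
    \<open>real t * m\<close>, as the tail bound demands.\<close>
  have "\<delta> / 2 * (1 - p) \<le> 1/2 * 1"
    using p \<open>\<delta> < 1\<close> by (intro mult_mono) auto
  with K have "exp (7 / 8 * c * g) < 1" by linarith
  then have g0: "g \<le> 0"
    using \<open>0 < c\<close> by (simp add: zero_less_mult_iff mult_less_0_iff)
  define B where "B n = {\<omega> \<in> space M. X (Suc n) \<omega> \<le> g}" for n
  have Bs: "B n \<in> sets M" for n
    using distributed_measurable[OF X[of "Suc n"]] unfolding B_def by simp
  have Bp: "prob (B n) \<le> 1/2 * exp (7 / 8 * c * g) * q * q ^ n" for n
  proof -
    have "g \<le> real (Suc n) * m"
      using g0 \<open>0 < m\<close> by (meson less_imp_le mult_nonneg_nonneg of_nat_0_le_iff order_trans)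
    then have "prob (B n) \<le> 1/2 * exp (7/8 * c * g - 7/8 * (1 - 7/8) * c * m * real (Suc n))"
      unfolding B_def using assms by (intro drifting_normal_tail[OF X s]) auto
    also have "\<dots> = 1/2 * exp (7 / 8 * c * g) * q ^ Suc n"
      unfolding q_def exp_of_nat_mult[symmetric] by (simp add: exp_add[symmetric] algebra_simps)
    finally show ?thesis by (simp add: mult_ac)
  qed
  have geo: "(\<lambda>n. 1/2 * exp (7 / 8 * c * g) * q * q ^ n) sums (1/2 * exp (7 / 8 * c * g) * q * (1 / (1 - q)))"
    using q by (intro sums_mult geometric_sums) auto
  have sB: "summable (\<lambda>n. prob (B n))"
    using Bp by (intro summable_comparison_test'[OF sums_summable[OF geo], of 0]) auto
  have "A \<subseteq> (\<Union>n. B n)"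
  proof
    fix \<omega> assume "\<omega> \<in> A"
    with A obtain t where "1 \<le> t" "X t \<omega> \<le> g" "\<omega> \<in> space M" by auto
    then show "\<omega> \<in> (\<Union>n. B n)"
      by (cases t) (auto simp: B_def)
  qed
  then have "prob A \<le> prob (\<Union>n. B n)"
    using Bs by (intro finite_measure_mono) auto
  also have "\<dots> \<le> (\<Sum>n. prob (B n))"
    using Bs sB by (intro finite_measure_subadditive_countably) auto
  also have "\<dots> \<le> 1/2 * exp (7 / 8 * c * g) * q * (1 / (1 - q))"
    using suminf_le[OF Bp sB sums_summable[OF geo]] sums_unique[OF geo] by simp
  also have "\<dots> \<le> 1/2 * (\<delta> / 2 * (1 - p)) * 1 * (1 / (1 - q))"
    using K q p \<open>0 < \<delta>\<close> by (intro mult_mono) auto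
  also have "\<dots> \<le> 1/2 * (\<delta> / 2 * (3 * (1 - q))) * 1 * (1 / (1 - q))"
  proof -
    \<comment> \<open>The threshold contains \<open>p\<close>, the series \<open>q\<close>. Since
      21/64 \<ge> 1/4, comparing them costs a factor 3, which the two factors 1/2 absorb: 3/4 <
      1.\<close>
    have "q ^ 3 \<le> p"
      unfolding q_def p_def exp_of_nat_mult[symmetric] using cm by simp
    moreover have "1 - q ^ 3 = (1 - q) * (1 + q + q\<^sup>2)"
      by (simp add: power2_eq_square power3_eq_cube algebra_simps)
    moreover have "(1 - q) * (1 + q + q\<^sup>2) \<le> (1 - q) * 3"
      using q power_le_one[of q 2] by (intro mult_left_mono) auto
    ultimately have "1 - p \<le> 3 * (1 - q)" by linarith
    then show ?thesis
      using q \<open>0 < \<delta>\<close> by (intro mult_right_mono mult_left_mono) auto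
  qed
  also have "\<dots> = 3/4 * \<delta>"
    using q by (simp add: divide_simps)
  also have "\<dots> \<le> \<delta>"
    using \<open>0 < \<delta>\<close> by simp
  finally show ?thesis .
qed

section \<open>Exit times and almost sure stopping\<close>

text \<open>A nonempty set in \<open>enat\<close> attains its infimum by well-ordering; the empty
  set has infimum \<infinity>.\<close>

lemma exit_time_cases:
  obtains "\<And>t. 1 \<le> t \<Longrightarrow> f t \<omega> \<in> {l..h}" and "exit_time f l h \<omega> = \<infinity>"
  | T where "1 \<le> T" and "f T \<omega> \<notin> {l..h}" and "exit_time f l h \<omega> = enat T"
proof (cases "\<exists>t\<ge>1. f t \<omega> \<notin> {l..h}")
  case True
  then obtain t where "enat t \<in> {enat t |t. 1 \<le> t \<and> f t \<omega> \<notin> {l..h}}" by auto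
  then have "exit_time f l h \<omega> \<in> {enat t |t. 1 \<le> t \<and> f t \<omega> \<notin> {l..h}}"
    unfolding exit_time_def by (rule wellorder_InfI)
  then show thesis using that(2) by blast
next
  case False
  then have "{enat t |t. 1 \<le> t \<and> f t \<omega> \<notin> {l..h}} = {}" by blast
  then have "exit_time f l h \<omega> = \<infinity>"
    unfolding exit_time_def by (simp add: Inf_enat_def)
  with False show thesis using that(1) by blast
qed

lemma exit_time_less_infinity_iff:
  "exit_time f l h \<omega> < \<infinity> \<longleftrightarrow> (\<exists>t\<ge>1. f t \<omega> \<notin> {l..h})"
  by (rule exit_time_cases[of f \<omega> l h]) auto

lemma exit_time_the_enat_ge_1:
  "exit_time f l h \<omega> < \<infinity> \<Longrightarrow> 1 \<le> the_enat (exit_time f l h \<omega>)"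
  by (rule exit_time_cases[of f \<omega> l h]) auto

text \<open>Never stopping forces \<open>X t\<close> to stay at or below \<open>h\<close> at each
  time; the tail bound with a = 1/2 makes the probability of this at time \<open>t\<close> tend to
  0.\<close>

lemma (in prob_space) drifting_normal_prob_stops:
  assumes X: "\<And>t. 1 \<le> t \<Longrightarrow> distributed M lborel (X t) (normal_density (real t * m) (s t))"
    and s: "\<And>t. 1 \<le> t \<Longrightarrow> 0 < s t" "\<And>t. 1 \<le> t \<Longrightarrow> (s t)\<^sup>2 \<le> 2 * m * real t / c"
    and "0 < m" "0 < c"
  shows "prob_stops M X l h = 1"
proof -
  define F where "F = {\<omega> \<in> space M. \<forall>t\<ge>1. X t \<omega> \<in> {l..h}}"
  have [measurable]: "X (Suc t) \<in> borel_measurable M" for t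
    using distributed_measurable[OF X[of "Suc t"]] by simp
  \<comment> \<open>Measurability of \<open>X t\<close> is available only from time 1 on, hence the
    shift.\<close>
  have "F = {\<omega> \<in> space M. \<forall>t. X (Suc t) \<omega> \<in> {l..h}}"
    unfolding F_def by (auto simp: Suc_le_eq gr0_conv_Suc)
  then have F: "F \<in> sets M" by simp
  have ev: "\<forall>\<^sub>F t in sequentially. prob F \<le> 1/2 * exp (1/2 * c * h - 1/2 * (1 - 1/2) * c * m * real t)"
  proof -
    have "\<forall>\<^sub>F t in sequentially. h \<le> real t * m"
      using \<open>0 < m\<close> by real_asymp
    moreover have "\<forall>\<^sub>F t in sequentially. 1 \<le> (t :: nat)"
      by (rule eventually_ge_at_top)
    ultimately show ?thesis
    proof eventually_elim
      case (elim t)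
      have "X t \<in> borel_measurable M"
        using distributed_measurable[OF X[of t]] elim by simp
      then have "prob F \<le> \<P>(\<omega> in M. X t \<omega> \<le> h)"
        using elim by (intro finite_measure_mono) (auto simp: F_def)
      also have "\<dots> \<le> 1/2 * exp (1/2 * c * h - 1/2 * (1 - 1/2) * c * m * real t)"
        using elim assms by (intro drifting_normal_tail[OF X s]) auto
      finally show ?case .
    qed
  qed
  have lim: "(\<lambda>t. 1/2 * exp (1/2 * c * h - 1/2 * (1 - 1/2) * c * m * real t)) \<longlonglongrightarrow> 0"
    using \<open>0 < m\<close> \<open>0 < c\<close> by real_asymp
  have "prob F \<le> 0"
    by (rule tendsto_lowerbound[OF lim ev]) simp
  then have "prob F = 0"
    using measure_nonneg[of M F] by linarith
  moreover have "{\<omega> \<in> space M. exit_time X l h \<omega> < \<infinity>} = space M - F"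
    unfolding F_def exit_time_less_infinity_iff by auto
  ultimately show ?thesis
    unfolding prob_stops_def using prob_compl[OF F] by simp
qed

section \<open>Error and stopping guarantees of the distributed test\<close>

theorem theorem4p1:
  fixes P0 P1 :: "'w measure"
    and y :: "'n::finite \<Rightarrow> nat \<Rightarrow> 'w \<Rightarrow> real"
    and E :: "('n \<times> 'n) set"
    and W :: "real ^ 'n ^ 'n"
    and \<mu> \<sigma> m r k \<alpha> \<beta> :: real
    and S :: "'n \<Rightarrow> nat \<Rightarrow> 'w \<Rightarrow> real"
  assumes "\<mu> \<noteq> 0" and "\<sigma> > 0"
    and "gaussian_observations P0 y (- \<mu>) \<sigma>"
    and "gaussian_observations P1 y \<mu> \<sigma>"
    and "simple_connected_graph E"
    and "weight_matrix E W"
    and "m = 2 * \<mu>\<^sup>2 / \<sigma>\<^sup>2"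
    and "r = mixing_rate W" and "r < 1"
    and "k = real CARD('n) * r\<^sup>2"
    and "S = (\<lambda>i t \<omega>. agent_stats W (llr \<mu> \<sigma> y) t \<omega> $ i)"
    and "0 < \<alpha>" and "\<alpha> < 1/2" and "0 < \<beta>" and "\<beta> < 1/2"
  shows "(\<exists>\<gamma>l \<gamma>h :: 'n \<Rightarrow> real. \<forall>i.
            prob_false_alarm P0 (S i) (\<gamma>l i) (\<gamma>h i) \<le> \<alpha> \<and>
            prob_miss P1 (S i) (\<gamma>l i) (\<gamma>h i) \<le> \<beta> \<and>
            prob_stops P1 (S i) (\<gamma>l i) (\<gamma>h i) = 1) \<and>
         (\<forall>i. \<forall>\<gamma>l \<gamma>h :: real.
            \<gamma>h \<ge> threshold_high (real CARD('n)) k m \<alpha> \<and>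
            \<gamma>l \<le> threshold_low (real CARD('n)) k m \<beta> \<longrightarrow>
              prob_stops P1 (S i) \<gamma>l \<gamma>h = 1 \<and>
              prob_false_alarm P0 (S i) \<gamma>l \<gamma>h \<le> \<alpha> \<and>
              prob_miss P1 (S i) \<gamma>l \<gamma>h \<le> \<beta>)"
proof -
  let ?N = "real CARD('n)"
  \<comment> \<open>The reciprocal of 1/N + r^2, the bound on the squared norm of the
    weights.\<close>
  define c where "c = ?N / (k + 1)"
  have N: "0 < ?N" by simp
  have k0: "0 \<le> k" using assms by simp
  have c0: "0 < c" using N k0 by (simp add: c_def)
  have m0: "0 < m" using assms by simp
  have W: "transpose W = W" "\<And>i. (\<Sum>j\<in>UNIV. W $ i $ j) = 1" "mixing_rate W < 1"
    using assms by (auto simp: weight_matrix_def)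
  have var: "4 * \<mu>\<^sup>2 / \<sigma>\<^sup>2 * (real t * (1 / ?N + (mixing_rate W)\<^sup>2)) = 2 * m * real t / c" for t
    using N k0 unfolding c_def \<open>m = _\<close> \<open>k = _\<close> \<open>r = mixing_rate W\<close> by (simp add: field_simps)
  have normal: "\<exists>s. \<forall>t\<ge>1. 0 < s t \<and> (s t)\<^sup>2 \<le> 2 * m * real t / c \<and>
      distributed M lborel (S i t) (normal_density (real t * (2 * \<mu> * a / \<sigma>\<^sup>2)) (s t))"
    if "gaussian_observations M y a \<sigma>" for M a i
  proof -
    have "\<exists>s. 0 < s \<and> s\<^sup>2 \<le> 2 * m * real t / c \<and>
      distributed M lborel (S i t) (normal_density (real t * (2 * \<mu> * a / \<sigma>\<^sup>2)) s)" if "1 \<le> t" for t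
      using agent_stats_normal[OF \<open>gaussian_observations M y a \<sigma>\<close> \<open>\<sigma> > 0\<close> \<open>\<mu> \<noteq> 0\<close> W that, of i]
      unfolding var \<open>S = _\<close> by metis
    then show ?thesis by metis
  qed
  \<comment> \<open>Since ln (\<beta>/2) = - ln (2/\<beta>), the two thresholds mirror each other
    and one crossing lemma serves both errors.\<close>
  have thr: "threshold_high ?N k m \<alpha> = 8 / (7 * c) * (ln (2 / \<alpha>) - ln (1 - exp (- (c * m / 4))))"
    "threshold_low ?N k m \<beta> = - (8 / (7 * c) * (ln (2 / \<beta>) - ln (1 - exp (- (c * m / 4)))))"
    using assms N k0
    by (simp_all add: threshold_high_def threshold_low_def c_def ln_div algebra_simps)
  interpret P0: prob_space P0 using assms(3) by (simp add: gaussian_observations_def)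
  interpret P1: prob_space P1 using assms(4) by (simp add: gaussian_observations_def)
  have main: "prob_stops P1 (S i) \<gamma>l \<gamma>h = 1 \<and> prob_false_alarm P0 (S i) \<gamma>l \<gamma>h \<le> \<alpha> \<and>
      prob_miss P1 (S i) \<gamma>l \<gamma>h \<le> \<beta>"
    if h: "threshold_high ?N k m \<alpha> \<le> \<gamma>h" and l: "\<gamma>l \<le> threshold_low ?N k m \<beta>" for i \<gamma>l \<gamma>h
  proof -
    obtain s1 where s1: "\<And>t. 1 \<le> t \<Longrightarrow> 0 < s1 t" "\<And>t. 1 \<le> t \<Longrightarrow> (s1 t)\<^sup>2 \<le> 2 * m * real t / c"
      "\<And>t. 1 \<le> t \<Longrightarrow> distributed P1 lborel (S i t) (normal_density (real t * m) (s1 t))"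
      using normal[OF assms(4), of i] unfolding \<open>m = _\<close> power2_eq_square[of \<mu>] mult.assoc by metis
    obtain s0 where s0: "\<And>t. 1 \<le> t \<Longrightarrow> 0 < s0 t" "\<And>t. 1 \<le> t \<Longrightarrow> (s0 t)\<^sup>2 \<le> 2 * m * real t / c"
      "\<And>t. 1 \<le> t \<Longrightarrow>
        distributed P0 lborel (S i t) (normal_density (real t * (2 * \<mu> * - \<mu> / \<sigma>\<^sup>2)) (s0 t))"
      using normal[OF assms(3), of i] by metis
    \<comment> \<open>Under \<open>P0\<close> the drift is -m; negation makes it +m and turns a
      false alarm into a fall to \<open>- \<gamma>h\<close> or below.\<close>
    have neg: "distributed P0 lborel (\<lambda>\<omega>. - S i t \<omega>) (normal_density (real t * m) (s0 t))"
      if "1 \<le> t" for t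
      using P0.normal_density_affine[OF s0(3)[OF that] s0(1)[OF that], of "-1" 0]
      by (simp add: \<open>m = _\<close> power2_eq_square mult.assoc)
    have "prob_false_alarm P0 (S i) \<gamma>l \<gamma>h \<le> \<alpha>"
      unfolding prob_false_alarm_def
      using h \<open>0 < \<alpha>\<close> \<open>\<alpha> < 1/2\<close> m0 c0 unfolding thr
      by (intro P0.drifting_normal_ever_below[where g = "- \<gamma>h", OF neg s0(1,2)])
         (use exit_time_the_enat_ge_1 in fastforce)+
    moreover have "prob_miss P1 (S i) \<gamma>l \<gamma>h \<le> \<beta>"
      unfolding prob_miss_def
      using l \<open>0 < \<beta>\<close> \<open>\<beta> < 1/2\<close> m0 c0 unfolding thr
      by (intro P1.drifting_normal_ever_below[where g = \<gamma>l, OF s1(3) s1(1,2)])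
         (use exit_time_the_enat_ge_1 in fastforce)+
    moreover have "prob_stops P1 (S i) \<gamma>l \<gamma>h = 1"
      by (rule P1.drifting_normal_prob_stops[OF s1(3) s1(1,2) m0 c0])
    ultimately show ?thesis by simp
  qed
  show ?thesis
    \<comment> \<open>The boundary thresholds themselves witness the existence claim.\<close>
    using main
    by (intro conjI exI[of _ "\<lambda>_. threshold_low ?N k m \<beta>"] exI[of _ "\<lambda>_. threshold_high ?N k m \<alpha>"])
       simp_all
qed

end
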